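(* Let $t,f,d$ be positive integers with $\lfloor \frac{t}{f}\rfloor\ge 4$ and $0<d<f$. Then an optimal discreet weighing strategy $\mathcal{A}$ for the parameters $t,f,d$ satisfies $$|W(\mathbf{s}|Z_f,\mathcal{A})|\ \ge\ \Bigl(\Bigl\lfloor \frac{t}{f}\Bigr\rfloor-2\Bigr)^{t-f\lfloor \frac{t}{f}\rfloor}\Bigl(\Bigl\lfloor \frac{t}{f}\Bigr\rfloor-3\Bigr)^{f-t+f\lfloor \frac{t}{f}\rfloor}+2^{\,f-t+f\lfloor \frac{t}{f}\rfloor}+2^{\,t-f\lfloor \frac{t}{f}\rfloor}.$$
   Context: There are $t$ coins that look identical. Genuine coins all have the same weight $w_1$, and fake coins all have the same weight $w_0<w_1$. A situation is a vector $\mathbf{z}\in\{0,1\}^t$, where $z_i=0$ means that coin $i$ is fake and $z_i=1$ means that it is genuine. For $0\le n\le t$, $Z_n$ is the set of situations with exactly $n$ fake coins, so $|Z_n|=\binom{t}{n}$. The true situation $\mathbf{x}\in Z_f$ is known to the person weighing. An observer knows only that the number of fake coins is $f$ or $d$, and sees the weighings and their results. A weighing is a nonzero vector $\mathbf{h}\in\{-1,0,1\}^t$ with $\sum_i h_i=0$ ($h_i=-1$: coin $i$ on the left pan; $h_i=1$: right pan; $h_i=0$: not weighed). Its result in situation $\mathbf{z}$ is $s(\mathbf{z},\mathbf{h})=\mathrm{sign}(\mathbf{z}\cdot\mathbf{h})\in\{-1,0,1\}$. A weighing strategy $\mathcal{A}$ of length $m$ is a rule producing consecutive weighings $\mathbf{h}^1,\dots,\mathbf{h}^m$,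 where $\mathbf{h}^1$ is fixed and each later weighing is either fixed in advance or determined by the earlier results. The syndrome of $\mathbf{z}$ is the sequence of results $\mathbf{s}(\mathbf{z}|\mathcal{A})=(s(\mathbf{z},\mathbf{h}^1),\dots,s(\mathbf{z},\mathbf{h}^m))$ when $\mathcal{A}$ is carried out in situation $\mathbf{z}$. For a set $Z$ of situations, $W(\mathbf{s}|Z,\mathcal{A})=\{\mathbf{z}\in Z:\mathbf{s}(\mathbf{z}|\mathcal{A})=\mathbf{s}\}$. Throughout, $\mathbf{s}=\mathbf{s}(\mathbf{x}|\mathcal{A})$ is the syndrome actually observed. $\mathcal{A}$ is successful if $|W(\mathbf{s}|Z_d,\mathcal{A})|=0$ and $|W(\mathbf{s}|Z_f,\mathcal{A})|>0$. A successful strategy is discreet if for every $1\le i\le t$ the entry $z_i$ takes both values $0$ and $1$ as $\mathbf{z}$ ranges over $W(\mathbf{s}|Z_f,\mathcal{A})$. An optimal discreet strategy is a successful discreet strategy with the largest possible value of $|W(\mathbf{s}|Z_f,\mathcal{A})|$ among successful discreet strategies for the given $t,f,d$. *)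

theory Defs
  imports Main "HOL-Library.FuncSet"
begin

text \<open>
  Coins are numbered \<open>1, \<dots>, t\<close>. Vectors of length \<open>t\<close> are extensional functions on \<open>{1..t}\<close>,
  so that counting them counts vectors. In a situation, \<open>0\<close> marks a fake and \<open>1\<close> a genuine coin.
\<close>

definition situations :: "nat \<Rightarrow> nat \<Rightarrow> (nat \<Rightarrow> int) set" where
  "situations t n = {z \<in> {1..t} \<rightarrow>\<^sub>E {0, 1}. card {i \<in> {1..t}. z i = 0} = n}"

definition weighings :: "nat \<Rightarrow> (nat \<Rightarrow> int) set" where
  "weighings t =
    {h \<in> {1..t} \<rightarrow>\<^sub>E {-1, 0, 1}. (\<exists>i\<in>{1..t}. h i \<noteq> 0) \<and> (\<Sum>i\<in>{1..t}. h i) = 0}"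

definition outcome :: "nat \<Rightarrow> (nat \<Rightarrow> int) \<Rightarrow> (nat \<Rightarrow> int) \<Rightarrow> int" where
  "outcome t z h = sgn (\<Sum>i\<in>{1..t}. z i * h i)"

text \<open>
  A strategy of length \<open>m\<close> is given by a rule \<open>A\<close> that maps the list of results obtained so far
  (earliest first) to the next weighing; \<open>A []\<close> is the first weighing. Weighings fixed in
  advance are those for which \<open>A\<close> depends on the length of the list only.
\<close>

type_synonym rule = "int list \<Rightarrow> nat \<Rightarrow> int"

definition strategy :: "nat \<Rightarrow> nat \<Rightarrow> rule \<Rightarrow> bool" where
  "strategy t m A \<longleftrightarrow>
    1 \<le> m \<and> (\<forall>rs. set rs \<subseteq> {-1, 0, 1} \<and> length rs < m \<longrightarrow> A rs \<in> weighings t)"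

primrec syndrome :: "nat \<Rightarrow> nat \<Rightarrow> rule \<Rightarrow> (nat \<Rightarrow> int) \<Rightarrow> int list" where
  "syndrome t 0 A z = []"
| "syndrome t (Suc m) A z = syndrome t m A z @ [outcome t z (A (syndrome t m A z))]"

definition W :: "nat \<Rightarrow> int list \<Rightarrow> (nat \<Rightarrow> int) set \<Rightarrow> nat \<Rightarrow> rule \<Rightarrow> (nat \<Rightarrow> int) set" where
  "W t s Z m A = {z \<in> Z. syndrome t m A z = s}"

text \<open>
  Below, \<open>x\<close> is the true situation; it determines the observed syndrome \<open>syndrome t m A x\<close>.
\<close>

definition successful :: "nat \<Rightarrow> nat \<Rightarrow> nat \<Rightarrow> (nat \<Rightarrow> int) \<Rightarrow> nat \<Rightarrow> rule \<Rightarrow> bool" where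
  "successful t f d x m A \<longleftrightarrow>
    strategy t m A \<and>
    card (W t (syndrome t m A x) (situations t d) m A) = 0 \<and>
    card (W t (syndrome t m A x) (situations t f) m A) > 0"

definition discreet :: "nat \<Rightarrow> nat \<Rightarrow> nat \<Rightarrow> (nat \<Rightarrow> int) \<Rightarrow> nat \<Rightarrow> rule \<Rightarrow> bool" where
  "discreet t f d x m A \<longleftrightarrow>
    successful t f d x m A \<and>
    (\<forall>i\<in>{1..t}. (\<lambda>z. z i) ` W t (syndrome t m A x) (situations t f) m A = {0, 1})"

definition optimal_discreet :: "nat \<Rightarrow> nat \<Rightarrow> nat \<Rightarrow> (nat \<Rightarrow> int) \<Rightarrow> nat \<Rightarrow> rule \<Rightarrow> bool" where
  "optimal_discreet t f d x m A \<longleftrightarrow>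
    discreet t f d x m A \<and>
    (\<forall>m' A'. discreet t f d x m' A' \<longrightarrow>
       card (W t (syndrome t m' A' x) (situations t f) m' A')
         \<le> card (W t (syndrome t m A x) (situations t f) m A))"

end

theory Submission
  imports Defs
begin

text \<open>
  Write \<open>q = t div f\<close> and \<open>r = t mod f\<close>. It suffices to exhibit, for the true situation \<open>x\<close>, one
  discreet strategy that leaves at least the claimed number of situations possible. An optimal
  strategy exists because the counts are bounded by \<open>card (situations t f)\<close>, and it does no worse.

  The coins are divided into \<open>f\<close> piles, \<open>r\<close> of size \<open>q + 1\<close> and \<open>f - r\<close> of size \<open>q\<close>. A
  large pile cannot be weighed against a small one as a whole. Instead, pile \<open>i\<close> is covered
  by two overlapping blocks \<open>P i\<close> and \<open>Q i\<close> whose sizes \<open>q - 1\<close> and \<open>3\<close> do not depend on the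
  pile. The overlap absorbs the difference: it has one coin in a large pile and two in a small one.
  The strategy weighs \<open>P 0\<close> against every \<open>P i\<close> and \<open>Q 0\<close> against every \<open>Q i\<close>, and the labels are
  chosen so that all these weighings balance in the situation \<open>x\<close>.

  When everything balances, either every pile contains a fake coin or none does, so that a positive
  number of fake coins is at least \<open>f\<close> (\<open>even_split_imp_many_fakes\<close>); this excludes \<open>d\<close> fake coins.
  On the other hand, everything balances whenever each pile contains exactly one fake coin and these
  fake coins all lie in the parts \<open>P i - Q i\<close>, or all in \<open>P i \<inter> Q i\<close>, or all in \<open>Q i - P i\<close>
  (\<open>even_split_transversal\<close>). These parts have sizes \<open>q - 2\<close>, \<open>1\<close>, \<open>2\<close> in a large pile and
  \<open>q - 3\<close>, \<open>2\<close>, \<open>1\<close> in a small one, which gives the three summands of the bound. As \<open>q \<ge> 4\<close>,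
  all parts are nonempty, so each coin is fake in one of these situations and genuine in another.
\<close>

section \<open>Comparing two sets of coins\<close>

definition fakes :: "(nat \<Rightarrow> int) \<Rightarrow> nat set \<Rightarrow> nat" where
  "fakes z X = card {c \<in> X. z c = 0}"

definition comparison :: "nat \<Rightarrow> nat set \<Rightarrow> nat set \<Rightarrow> nat \<Rightarrow> int" where
  "comparison t X Y = (\<lambda>c\<in>{1..t}. if c \<in> X then -1 else if c \<in> Y then 1 else 0)"

lemma sum_restrict_subset:
  fixes g :: "'a \<Rightarrow> int"
  assumes "finite B" "X \<subseteq> B"
  shows "(\<Sum>i\<in>B. if i \<in> X then g i else 0) = sum g X"
  using assms by (simp add: sum.If_cases Int_absorb1)

lemma sum_mult_comparison:
  assumes "X \<subseteq> {1..t}" "Y \<subseteq> {1..t}" "X \<inter> Y = {}"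
  shows "(\<Sum>i\<in>{1..t}. z i * comparison t X Y i) = sum z Y - sum z X"
proof -
  have "(\<Sum>i\<in>{1..t}. z i * comparison t X Y i)
      = (\<Sum>i\<in>{1..t}. (if i \<in> Y then z i else 0) - (if i \<in> X then z i else 0))"
    using assms(3) by (intro sum.cong) (auto simp: comparison_def)
  also have "\<dots> = sum z Y - sum z X"
    using assms by (simp add: sum_subtractf sum_restrict_subset)
  finally show ?thesis .
qed

lemma comparison_in_weighings:
  assumes "X \<subseteq> {1..t}" "Y \<subseteq> {1..t}" "X \<inter> Y = {}" "X \<noteq> {}" "card X = card Y"
  shows "comparison t X Y \<in> weighings t"
proof -
  have "(\<Sum>i\<in>{1..t}. comparison t X Y i) = 0"
    using sum_mult_comparison[OF assms(1-3), of "\<lambda>_. 1"] assms(5) by simp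
  moreover have "\<exists>i\<in>{1..t}. comparison t X Y i \<noteq> 0"
    using assms(1,4) by (force simp: comparison_def)
  moreover have "comparison t X Y \<in> {1..t} \<rightarrow>\<^sub>E {-1, 0, 1}"
    by (auto simp: comparison_def)
  ultimately show ?thesis by (simp add: weighings_def)
qed

lemma situation_value:
  assumes "z \<in> situations t n" "c \<in> {1..t}"
  shows "z c = 0 \<or> z c = 1"
  using assms unfolding situations_def by blast

lemma sum_situation:
  assumes "z \<in> situations t n" "X \<subseteq> {1..t}"
  shows "sum z X = int (card X) - int (fakes z X)"
proof -
  have fin: "finite X" using assms(2) finite_subset by blast
  have "z c = 0 \<or> z c = 1" if "c \<in> X" for c
    using situation_value assms that by blast
  hence "sum z X = (\<Sum>c\<in>X. 1 - (if c \<in> {c \<in> X. z c = 0} then 1 else 0))"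
    by (intro sum.cong) force+
  also have "\<dots> = int (card X) - int (fakes z X)"
    unfolding sum_subtractf
    by (subst sum_restrict_subset[OF fin]) (auto simp: fakes_def)
  finally show ?thesis .
qed

lemma outcome_comparison_eq_0_iff:
  assumes "z \<in> situations t n" "X \<subseteq> {1..t}" "Y \<subseteq> {1..t}" "X \<inter> Y = {}" "card X = card Y"
  shows "outcome t z (comparison t X Y) = 0 \<longleftrightarrow> fakes z Y = fakes z X"
  unfolding outcome_def sum_mult_comparison[OF assms(2-4)]
  using assms by (auto simp: sum_situation sgn_0_0)

section \<open>Weighings fixed in advance\<close>

definition fixed_rule :: "(nat \<Rightarrow> int) list \<Rightarrow> rule" where
  "fixed_rule hs = (\<lambda>rs. hs ! length rs)"

lemma strategy_fixed_rule:
  assumes "hs \<noteq> []" "set hs \<subseteq> weighings t"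
  shows "strategy t (length hs) (fixed_rule hs)"
  using assms nth_mem by (fastforce simp: strategy_def fixed_rule_def Suc_le_eq)

lemma syndrome_fixed_rule:
  "syndrome t (length hs) (fixed_rule hs) z = map (outcome t z) hs"
proof -
  have "m \<le> length hs \<Longrightarrow>
      syndrome t m (fixed_rule hs) z = map (outcome t z) (take m hs)" for m
    by (induction m) (auto simp: fixed_rule_def take_Suc_conv_app_nth)
  from this[of "length hs"] show ?thesis by simp
qed

section \<open>Piles covered by two blocks\<close>

text \<open>
  Two piles at least are needed because a strategy must contain a weighing. The three parts into
  which the blocks cut each pile are nonempty so that a fake coin can be put in any of them.
\<close>

locale piling =
  fixes t f :: nat and P Q :: "nat \<Rightarrow> nat set" and p k :: nat
  assumes two_le: "2 \<le> f"
    and cover: "(\<Union>i<f. P i \<union> Q i) = {1..t}"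
    and disjoint: "\<And>i j. i < f \<Longrightarrow> j < f \<Longrightarrow> i \<noteq> j \<Longrightarrow> (P i \<union> Q i) \<inter> (P j \<union> Q j) = {}"
    and card_P: "\<And>i. i < f \<Longrightarrow> card (P i) = p"
    and card_Q: "\<And>i. i < f \<Longrightarrow> card (Q i) = k"
    and P_minus_Q: "\<And>i. i < f \<Longrightarrow> P i - Q i \<noteq> {}"
    and P_Int_Q: "\<And>i. i < f \<Longrightarrow> P i \<inter> Q i \<noteq> {}"
    and Q_minus_P: "\<And>i. i < f \<Longrightarrow> Q i - P i \<noteq> {}"
begin

definition comparisons :: "(nat \<Rightarrow> int) list" where
  "comparisons =
     map (\<lambda>i. comparison t (P 0) (P i)) [1..<f] @ map (\<lambda>i. comparison t (Q 0) (Q i)) [1..<f]"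

definition even_split :: "(nat \<Rightarrow> int) \<Rightarrow> bool" where
  "even_split z \<longleftrightarrow> (\<forall>i<f. fakes z (P i) = fakes z (P 0) \<and> fakes z (Q i) = fakes z (Q 0))"

lemma block_subset: "i < f \<Longrightarrow> P i \<subseteq> {1..t}" "i < f \<Longrightarrow> Q i \<subseteq> {1..t}"
  using cover by blast+

lemma finite_block: "i < f \<Longrightarrow> finite (P i)" "i < f \<Longrightarrow> finite (Q i)"
  by (meson block_subset finite_atLeastAtMost finite_subset)+

lemma block_disjoint:
  assumes "0 < i" "i < f"
  shows "P 0 \<inter> P i = {}" "Q 0 \<inter> Q i = {}"
  using disjoint[of 0 i] assms by auto

lemma strategy_comparisons: "strategy t (length comparisons) (fixed_rule comparisons)"
proof (rule strategy_fixed_rule)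
  show "comparisons \<noteq> []" using two_le by (simp add: comparisons_def)
  have "P 0 \<noteq> {}" "Q 0 \<noteq> {}" using P_minus_Q[of 0] Q_minus_P[of 0] two_le by auto
  hence "comparison t (P 0) (P i) \<in> weighings t" "comparison t (Q 0) (Q i) \<in> weighings t"
    if "0 < i" "i < f" for i
    using that block_subset[of 0] block_subset[of i] block_disjoint[of i]
      card_P[of 0] card_P[of i] card_Q[of 0] card_Q[of i]
    by (intro comparison_in_weighings; simp)+
  thus "set comparisons \<subseteq> weighings t" by (auto simp: comparisons_def)
qed

lemma outcomes_eq_0_iff:
  assumes "z \<in> situations t n"
  shows "(\<forall>h\<in>set comparisons. outcome t z h = 0) \<longleftrightarrow> even_split z"
proof -
  have P: "outcome t z (comparison t (P 0) (P i)) = 0 \<longleftrightarrow> fakes z (P i) = fakes z (P 0)"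
    and Q: "outcome t z (comparison t (Q 0) (Q i)) = 0 \<longleftrightarrow> fakes z (Q i) = fakes z (Q 0)"
    if "0 < i" "i < f" for i
    using that block_subset[of 0] block_subset[of i] block_disjoint[of i]
      card_P[of 0] card_P[of i] card_Q[of 0] card_Q[of i]
    by (intro outcome_comparison_eq_0_iff[OF assms]; simp)+
  have "(\<forall>h\<in>set comparisons. outcome t z h = 0) \<longleftrightarrow>
      (\<forall>i. 0 < i \<and> i < f \<longrightarrow> fakes z (P i) = fakes z (P 0) \<and> fakes z (Q i) = fakes z (Q 0))"
    using P Q by (auto simp: comparisons_def Suc_le_eq)
  also have "\<dots> \<longleftrightarrow> even_split z"
    unfolding even_split_def by (metis gr0I)
  finally show ?thesis .
qed

lemma same_syndrome_iff:
  assumes "x \<in> situations t n" "even_split x" "z \<in> situations t n'"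
  shows "syndrome t (length comparisons) (fixed_rule comparisons) z =
         syndrome t (length comparisons) (fixed_rule comparisons) x \<longleftrightarrow> even_split z"
proof -
  have "\<forall>h\<in>set comparisons. outcome t x h = 0"
    using outcomes_eq_0_iff assms by blast
  thus ?thesis
    unfolding syndrome_fixed_rule using outcomes_eq_0_iff[OF assms(3)] by auto
qed

lemma W_comparisons:
  assumes "x \<in> situations t n" "even_split x"
  shows "W t (syndrome t (length comparisons) (fixed_rule comparisons) x) (situations t n')
           (length comparisons) (fixed_rule comparisons)
         = {z \<in> situations t n'. even_split z}"
  using same_syndrome_iff[OF assms] by (auto simp: W_def)

text \<open>
  Since the blocks cover a pile, the pile is free of fakes exactly when both of its blocks are, and
  this happens in all piles or in none. Coins in the overlap of two blocks do no harm: only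
  emptiness is compared, not the number of fakes in a pile.
\<close>

lemma even_split_imp_many_fakes:
  assumes "z \<in> situations t n" "even_split z" "n \<noteq> 0"
  shows "f \<le> n"
proof -
  define F where "F i = {c \<in> P i \<union> Q i. z c = 0}" for i
  have fin: "finite (F i)" if "i < f" for i
    using that finite_block by (simp add: F_def)
  have un: "(\<Union>i<f. F i) = {c \<in> {1..t}. z c = 0}"
    unfolding F_def cover[symmetric] by auto
  have "card (\<Union>i<f. F i) = (\<Sum>i<f. card (F i))"
    using fin disjoint unfolding F_def by (intro card_UN_disjoint) (simp, simp, blast)
  hence n: "n = (\<Sum>i<f. card (F i))"
    using assms(1) un by (simp add: situations_def)
  have F_empty: "F i = {} \<longleftrightarrow> fakes z (P i) = 0 \<and> fakes z (Q i) = 0" if "i < f" for i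
    using finite_block[OF that] by (auto simp: F_def fakes_def)
  have "F i = {} \<longleftrightarrow> F 0 = {}" if "i < f" for i
  proof -
    have "fakes z (P i) = fakes z (P 0)" "fakes z (Q i) = fakes z (Q 0)"
      using assms(2) that unfolding even_split_def by blast+
    thus ?thesis using F_empty[OF that] F_empty[of 0] that by simp
  qed
  moreover have "\<exists>i<f. F i \<noteq> {}"
  proof (rule ccontr)
    assume "\<not> ?thesis"
    hence "(\<Sum>i<f. card (F i)) = 0" by simp
    thus False using n assms(3) by simp
  qed
  ultimately have "\<And>i. i < f \<Longrightarrow> F i \<noteq> {}" by blast
  hence "\<And>i. i < f \<Longrightarrow> 1 \<le> card (F i)" using fin by (simp add: Suc_le_eq card_gt_0_iff)
  hence "(\<Sum>i<f. 1) \<le> (\<Sum>i<f. card (F i))" by (intro sum_mono) auto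
  thus ?thesis using n by simp
qed

definition transversal :: "(nat \<Rightarrow> nat) \<Rightarrow> nat \<Rightarrow> int" where
  "transversal s = (\<lambda>c\<in>{1..t}. if c \<in> s ` {..<f} then 0 else 1)"

context
  fixes s :: "nat \<Rightarrow> nat"
  assumes s: "\<And>i. i < f \<Longrightarrow> s i \<in> P i \<union> Q i"
begin

lemma choice_in_pile_unique:
  assumes "i < f" "j < f" "s i \<in> P j \<union> Q j"
  shows "i = j"
  using disjoint[of i j] s[of i] assms by blast

lemma transversal_fakes_block:
  assumes "i < f" "X \<subseteq> P i \<union> Q i"
  shows "{c \<in> X. transversal s c = 0} = (if s i \<in> X then {s i} else {})"
proof -
  have "X \<subseteq> {1..t}" using assms block_subset by blast
  hence "{c \<in> X. transversal s c = 0} = {c \<in> X. c \<in> s ` {..<f}}"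
    by (auto simp: transversal_def)
  also have "\<dots> = (if s i \<in> X then {s i} else {})"
    using assms choice_in_pile_unique[OF _ assms(1)] by auto
  finally show ?thesis .
qed

lemma transversal_in_situations: "transversal s \<in> situations t f"
proof -
  have "inj_on s {..<f}"
    using choice_in_pile_unique s by (intro inj_onI) (metis lessThan_iff)
  moreover have "{c \<in> {1..t}. transversal s c = 0} = s ` {..<f}"
  proof -
    have "s ` {..<f} \<subseteq> {1..t}" using s cover by blast
    thus ?thesis by (auto simp: transversal_def)
  qed
  moreover have "transversal s \<in> {1..t} \<rightarrow>\<^sub>E {0, 1}"
    by (auto simp: transversal_def)
  ultimately show ?thesis by (simp add: situations_def card_image)
qed

text \<open>
  The block counts \<open>(fakes (P i), fakes (Q i))\<close> are \<open>(1, 0)\<close>, \<open>(1, 1)\<close> or \<open>(0, 1)\<close> according to the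
  part in which \<open>s i\<close> lies; hence the same part has to be used in all piles.
\<close>

lemma even_split_transversal:
  assumes "(\<forall>i<f. s i \<in> P i - Q i) \<or> (\<forall>i<f. s i \<in> P i \<inter> Q i) \<or> (\<forall>i<f. s i \<in> Q i - P i)"
  shows "even_split (transversal s)"
proof -
  have "fakes (transversal s) (P i) = (if s i \<in> P i then 1 else 0)"
    "fakes (transversal s) (Q i) = (if s i \<in> Q i then 1 else 0)" if "i < f" for i
    using transversal_fakes_block[OF that] by (auto simp: fakes_def)
  moreover have "0 < f" using two_le by simp
  ultimately show ?thesis using assms by (auto simp: even_split_def)
qed

end

definition choices :: "(nat \<Rightarrow> nat) set" where
  "choices = PiE {..<f} (\<lambda>i. P i - Q i) \<union> PiE {..<f} (\<lambda>i. P i \<inter> Q i) \<union> PiE {..<f} (\<lambda>i. Q i - P i)"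

lemma choices_in_pile: "s \<in> choices \<Longrightarrow> i < f \<Longrightarrow> s i \<in> P i \<union> Q i"
  by (auto simp: choices_def PiE_def Pi_def)

lemma transversal_choices:
  assumes "s \<in> choices"
  shows "transversal s \<in> {z \<in> situations t f. even_split z}"
proof -
  have "even_split (transversal s)"
    using choices_in_pile[OF assms] assms
    by (intro even_split_transversal) (auto simp: choices_def PiE_def Pi_def)
  thus ?thesis using transversal_in_situations choices_in_pile[OF assms] by blast
qed

lemma inj_on_transversal: "inj_on transversal choices"
proof (rule inj_onI)
  fix s s' assume s: "s \<in> choices" and s': "s' \<in> choices" and eq: "transversal s = transversal s'"
  have "s i = s' i" if "i < f" for i
    using transversal_fakes_block[OF choices_in_pile[OF s] that order_refl]
      transversal_fakes_block[OF choices_in_pile[OF s'] that order_refl]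
      choices_in_pile[OF s that] choices_in_pile[OF s' that] eq by simp
  moreover have "s i = s' i" if "\<not> i < f" for i
    using s s' that by (auto simp: choices_def PiE_def extensional_def)
  ultimately show "s = s'" by blast
qed

lemma card_choices:
  "card choices = (\<Prod>i<f. card (P i - Q i)) + (\<Prod>i<f. card (P i \<inter> Q i)) + (\<Prod>i<f. card (Q i - P i))"
proof -
  have f: "0 < f" using two_le by simp
  have fin: "finite (PiE {..<f} (\<lambda>i. P i - Q i))" "finite (PiE {..<f} (\<lambda>i. P i \<inter> Q i))"
    "finite (PiE {..<f} (\<lambda>i. Q i - P i))"
    using finite_block by (auto intro!: finite_PiE)
  have disj: "PiE {..<f} (\<lambda>i. P i - Q i) \<inter> PiE {..<f} (\<lambda>i. P i \<inter> Q i) = {}"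
    "(PiE {..<f} (\<lambda>i. P i - Q i) \<union> PiE {..<f} (\<lambda>i. P i \<inter> Q i)) \<inter> PiE {..<f} (\<lambda>i. Q i - P i) = {}"
    using f by (auto simp: PiE_def Pi_def)
  show ?thesis
    unfolding choices_def using fin disj by (simp add: card_Un_disjoint card_PiE)
qed

lemma choice_through:
  assumes "\<And>j. j < f \<Longrightarrow> R j \<noteq> {}" "c \<in> R i" "i < f"
  shows "\<exists>s\<in>PiE {..<f} R. s i = c"
proof -
  have "(\<lambda>j\<in>{..<f}. if j = i then c else (SOME e. e \<in> R j)) \<in> PiE {..<f} R"
    using assms by (auto simp: some_in_eq)
  thus ?thesis by (rule bexI[rotated]) (simp add: assms(3))
qed

text \<open>
  A coin becomes fake by choosing it together with coins from the same part of the other piles. It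
  is genuine in any situation whose fakes lie in another part than the coin itself, and at
  least one of two given parts is such.
\<close>

lemma coin_fake_or_genuine:
  assumes "c \<in> {1..t}"
  shows "\<exists>s\<in>choices. transversal s c = 0" "\<exists>s\<in>choices. transversal s c = 1"
proof -
  obtain i where i: "i < f" "c \<in> P i \<union> Q i" using assms cover by blast
  have val: "transversal s c = (if s i = c then 0 else 1)" if "s \<in> choices" for s
    using choice_in_pile_unique[OF choices_in_pile[OF that] _ i(1)] i assms
    by (auto simp: transversal_def)
  have "PiE {..<f} (\<lambda>i. P i - Q i) \<noteq> {}" "PiE {..<f} (\<lambda>i. P i \<inter> Q i) \<noteq> {}"
    using P_minus_Q P_Int_Q by (simp_all add: PiE_eq_empty_iff)
  then obtain u v where uv: "u \<in> PiE {..<f} (\<lambda>i. P i - Q i)" "v \<in> PiE {..<f} (\<lambda>i. P i \<inter> Q i)"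
    by blast
  hence ch: "u \<in> choices" "v \<in> choices" by (simp_all add: choices_def)
  \<comment> \<open>The two choices cannot coincide in pile \<open>i\<close>, so one of them avoids \<open>c\<close>.\<close>
  have "u i \<in> P i - Q i" "v i \<in> P i \<inter> Q i"
    using PiE_mem[OF uv(1)] PiE_mem[OF uv(2)] i(1) by blast+
  hence "u i \<noteq> c \<or> v i \<noteq> c" by auto
  thus "\<exists>s\<in>choices. transversal s c = 1" using val ch by metis
  consider "c \<in> P i - Q i" | "c \<in> P i \<inter> Q i" | "c \<in> Q i - P i" using i by blast
  hence "\<exists>s\<in>choices. s i = c"
  proof cases
    case 1 thus ?thesis using choice_through[of "\<lambda>i. P i - Q i"] P_minus_Q i
      unfolding choices_def by blast
  next
    case 2 thus ?thesis using choice_through[of "\<lambda>i. P i \<inter> Q i"] P_Int_Q i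
      unfolding choices_def by blast
  next
    case 3 thus ?thesis using choice_through[of "\<lambda>i. Q i - P i"] Q_minus_P i
      unfolding choices_def by blast
  qed
  thus "\<exists>s\<in>choices. transversal s c = 0" using val by metis
qed

end

lemma finite_situations: "finite (situations t n)"
  by (rule finite_subset[of _ "{1..t} \<rightarrow>\<^sub>E {0, 1}"]) (auto simp: situations_def intro: finite_PiE)

context piling
begin

lemma discreet_comparisons:
  assumes "x \<in> situations t f" "even_split x" "0 < d" "d < f"
  shows "discreet t f d x (length comparisons) (fixed_rule comparisons)"
proof -
  have "{z \<in> situations t d. even_split z} = {}"
    using even_split_imp_many_fakes assms(3,4) by fastforce
  hence "card {z \<in> situations t d. even_split z} = 0" by (simp only: card.empty)
  moreover have "0 < card {z \<in> situations t f. even_split z}"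
    using assms(1,2) finite_situations by (auto simp: card_gt_0_iff)
  moreover have "(\<lambda>z. z c) ` {z \<in> situations t f. even_split z} = {0, 1}" if c: "c \<in> {1..t}" for c
  proof
    show "(\<lambda>z. z c) ` {z \<in> situations t f. even_split z} \<subseteq> {0, 1}"
      using c situation_value by blast
    show "{0, 1} \<subseteq> (\<lambda>z. z c) ` {z \<in> situations t f. even_split z}"
      using coin_fake_or_genuine[OF c] transversal_choices by (auto simp: image_iff)
  qed
  ultimately show ?thesis
    unfolding discreet_def successful_def W_comparisons[OF assms(1,2)]
    using strategy_comparisons by simp
qed

lemma card_choices_le:
  "card choices \<le> card {z \<in> situations t f. even_split z}"
  using transversal_choices finite_situations
  by (intro card_inj_on_le[OF inj_on_transversal]) auto

end

section \<open>Building the piles around the fake coins\<close>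

lemma fake_coins_first:
  assumes "x \<in> situations t f"
  obtains b where "bij_betw b {..<t} {1..t}" "b ` {..<f} = {c \<in> {1..t}. x c = 0}"
proof -
  let ?F = "{c \<in> {1..t}. x c = 0}"
  have cF: "card ?F = f" using assms by (simp add: situations_def)
  have ft: "f \<le> t" using cF card_mono[of "{1..t}" ?F] by fastforce
  obtain b1 where b1: "bij_betw b1 {..<f} ?F"
    using cF finite_same_card_bij[of "{..<f}" ?F] by auto
  have "card {f..<t} = card ({1..t} - ?F)"
    using cF by (subst card_Diff_subset) auto
  then obtain b2 where b2: "bij_betw b2 {f..<t} ({1..t} - ?F)"
    using finite_same_card_bij[of "{f..<t}" "{1..t} - ?F"] by auto
  let ?b = "\<lambda>n. if n \<in> {..<f} then b1 n else b2 n"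
  have "bij_betw ?b ({..<f} \<union> {f..<t}) (?F \<union> ({1..t} - ?F))"
    by (rule bij_betw_disjoint_Un[OF b1 b2]) auto
  moreover have "{..<f} \<union> {f..<t} = {..<t}" using ft by auto
  moreover have "?F \<union> ({1..t} - ?F) = {1..t}" by auto
  moreover have "?b ` {..<f} = ?F" using b1 by (simp add: bij_betw_def)
  ultimately show ?thesis using that by metis
qed

text \<open>
  Number the coins from \<open>0\<close>, the fake ones first, and write them row by row into \<open>f\<close> columns. The
  columns are the piles, and the bottom row consists of the fake coins, one for each pile. The
  block \<open>P i\<close> is formed by the lowest \<open>q - 1\<close> coins of the column and \<open>Q i\<close> by its three highest.
  For \<open>q \<ge> 4\<close> they cover the column, and the bottom coin is not among the three highest, so that
  the fake coins of \<open>x\<close> lie in the parts \<open>P i - Q i\<close>.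
\<close>

lemma exists_piling:
  fixes t f :: nat
  defines "q \<equiv> t div f" and "r \<equiv> t mod f"
  assumes "2 \<le> f" "4 \<le> q" and x: "x \<in> situations t f"
  obtains P Q where "piling t f P Q (q - 1) 3"
    "\<And>i. i < f \<Longrightarrow> card (P i - Q i) = (if i < r then q - 2 else q - 3)"
    "\<And>i. i < f \<Longrightarrow> card (P i \<inter> Q i) = (if i < r then 1 else 2)"
    "\<And>i. i < f \<Longrightarrow> card (Q i - P i) = (if i < r then 2 else 1)"
    "\<exists>s. (\<forall>i<f. s i \<in> P i - Q i) \<and> {c \<in> {1..t}. x c = 0} = s ` {..<f}"
proof -
  obtain b where b: "bij_betw b {..<t} {1..t}" "b ` {..<f} = {c \<in> {1..t}. x c = 0}"
    using fake_coins_first[OF x] by metis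
  have tq: "t = q * f + r" by (simp add: q_def r_def)
  have rf: "r < f" using assms(3) by (simp add: r_def)
  define height where "height i = (if i < r then q + 1 else q)" for i
  define coin where "coin i l = b (l * f + i)" for i l
  define P where "P i = coin i ` {0..<q - 1}" for i
  define Q where "Q i = coin i ` {height i - 3..<height i}" for i
  have pos: "l * f + i < t" if "i < f" "l < height i" for i l
  proof (cases "l < q")
    case True
    hence "Suc l * f \<le> q * f" by (intro mult_le_mono1) simp
    thus ?thesis using that tq by simp
  next
    case False
    hence "l = q" "i < r" using that by (auto simp: height_def split: if_splits)
    thus ?thesis using tq by simp
  qed
  have pos': "\<exists>l<height i. n = l * f + i" if "n < t" "i = n mod f" for n i
  proof -
    have n: "n = n div f * f + i" using that by simp
    have "n div f \<le> q" using that by (simp add: q_def div_le_mono)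
    moreover have "i < r" if "n div f = q"
    proof -
      have "n = q * f + i" using n that by metis
      thus ?thesis using \<open>n < t\<close> tq by simp
    qed
    ultimately have "n div f < height i"
      using le_neq_implies_less by (fastforce simp: height_def)
    thus ?thesis using n by blast
  qed
  have coin_eq: "coin i l = coin j l' \<longleftrightarrow> i = j \<and> l = l'"
    if "i < f" "j < f" "l < height i" "l' < height j" for i j l l'
  proof -
    have "coin i l = coin j l' \<longleftrightarrow> l * f + i = l' * f + j"
      unfolding coin_def using b(1) pos that by (intro inj_on_eq_iff) (auto simp: bij_betw_def)
    also have "\<dots> \<longleftrightarrow> i = j \<and> l = l'"
    proof
      assume e: "l * f + i = l' * f + j"
      have "(l * f + i) mod f = i" "(l' * f + j) mod f = j" using that by auto
      hence "i = j" using e by metis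
      moreover hence "l = l'" using e that by simp
      ultimately show "i = j \<and> l = l'" by blast
    qed simp
    finally show ?thesis .
  qed
  have inj: "inj_on (coin i) {0..<height i}" if "i < f" for i
    using coin_eq that by (intro inj_onI) auto
  have sub: "{0..<q - 1} \<subseteq> {0..<height i}" "{height i - 3..<height i} \<subseteq> {0..<height i}" for i
    by (auto simp: height_def)
  have pile: "P i \<union> Q i = coin i ` {0..<height i}" for i
  proof -
    have "{0..<q - 1} \<union> {height i - 3..<height i} = {0..<height i}"
      using assms(4) by (auto simp: height_def)
    thus ?thesis by (simp add: P_def Q_def image_Un[symmetric])
  qed
  have PmQ: "P i - Q i = coin i ` {0..<height i - 3}" if "i < f" for i
  proof -
    have "{0..<q - 1} - {height i - 3..<height i} = {0..<height i - 3}"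
      using assms(4) by (auto simp: height_def)
    thus ?thesis unfolding P_def Q_def using inj_on_image_set_diff[OF inj[OF that]] sub
      by (metis (no_types, lifting) Diff_subset order_trans)
  qed
  have PiQ: "P i \<inter> Q i = coin i ` {height i - 3..<q - 1}" if "i < f" for i
  proof -
    have "{0..<q - 1} \<inter> {height i - 3..<height i} = {height i - 3..<q - 1}"
      using assms(4) by (auto simp: height_def)
    thus ?thesis unfolding P_def Q_def using inj_on_image_Int[OF inj[OF that]] sub by metis
  qed
  have QmP: "Q i - P i = coin i ` {q - 1..<height i}" if "i < f" for i
  proof -
    have "{height i - 3..<height i} - {0..<q - 1} = {q - 1..<height i}"
      using assms(4) by (auto simp: height_def)
    thus ?thesis unfolding P_def Q_def using inj_on_image_set_diff[OF inj[OF that]] sub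
      by (metis (no_types, lifting) Diff_subset order_trans)
  qed
  have card_coin: "card (coin i ` L) = card L" if "i < f" "L \<subseteq> {0..<height i}" for i L
    using inj[OF that(1)] that(2) by (intro card_image) (rule inj_on_subset)
  have c1: "card (P i - Q i) = (if i < r then q - 2 else q - 3)" if "i < f" for i
    unfolding PmQ[OF that] using that assms(4)
    by (subst card_coin) (auto simp: height_def)
  have c2: "card (P i \<inter> Q i) = (if i < r then 1 else 2)" if "i < f" for i
    unfolding PiQ[OF that] using that assms(4)
    by (subst card_coin) (auto simp: height_def)
  have c3: "card (Q i - P i) = (if i < r then 2 else 1)" if "i < f" for i
    unfolding QmP[OF that] using that assms(4)
    by (subst card_coin) (auto simp: height_def)
  have "piling t f P Q (q - 1) 3"
  proof
    show "2 \<le> f" by fact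
    have "(\<Union>i<f. P i \<union> Q i) = b ` {..<t}"
    proof (intro equalityI subsetI)
      fix c assume "c \<in> (\<Union>i<f. P i \<union> Q i)"
      thus "c \<in> b ` {..<t}" using pos by (auto simp: pile coin_def)
    next
      fix c assume "c \<in> b ` {..<t}"
      then obtain n where n: "n < t" "c = b n" by auto
      have "n mod f < f" using assms(3) by simp
      with pos'[OF n(1) refl] obtain l where "l < height (n mod f)" "n = l * f + n mod f" by blast
      hence "c = coin (n mod f) l" using n by (simp add: coin_def)
      hence "c \<in> P (n mod f) \<union> Q (n mod f)"
        using \<open>l < _\<close> unfolding pile by simp
      thus "c \<in> (\<Union>i<f. P i \<union> Q i)" using \<open>n mod f < f\<close> by blast
    qed
    thus "(\<Union>i<f. P i \<union> Q i) = {1..t}" using b(1) by (simp add: bij_betw_def)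
    show "(P i \<union> Q i) \<inter> (P j \<union> Q j) = {}" if "i < f" "j < f" "i \<noteq> j" for i j
      unfolding pile using that coin_eq by auto
    show "card (P i) = q - 1" if "i < f" for i
      unfolding P_def using card_coin[OF that sub(1)] by simp
    show "card (Q i) = 3" if "i < f" for i
      unfolding Q_def using card_coin[OF that sub(2)] assms(4) by (simp add: height_def)
    show "P i - Q i \<noteq> {}" "P i \<inter> Q i \<noteq> {}" "Q i - P i \<noteq> {}" if "i < f" for i
      unfolding PmQ[OF that] PiQ[OF that] QmP[OF that] using assms(4) by (auto simp: height_def)
  qed
  moreover have "\<exists>s. (\<forall>i<f. s i \<in> P i - Q i) \<and> {c \<in> {1..t}. x c = 0} = s ` {..<f}"
    using b(2) PmQ assms(4) by (intro exI[of _ b]) (auto simp: coin_def height_def image_iff intro!: bexI[of _ 0])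
  ultimately show ?thesis using that c1 c2 c3 by blast
qed

lemma (in piling) even_split_if_fakes_in_P_minus_Q:
  assumes "x \<in> situations t f" "\<And>i. i < f \<Longrightarrow> s i \<in> P i - Q i"
    "{c \<in> {1..t}. x c = 0} = s ` {..<f}"
  shows "even_split x"
proof -
  have "x = transversal s"
  proof
    fix c show "x c = transversal s c"
      using assms(1,3) by (cases "c \<in> {1..t}") (auto simp: transversal_def situations_def PiE_def Pi_def extensional_def)
  qed
  thus ?thesis using assms(2) by (auto intro: even_split_transversal)
qed

lemma prod_if_less:
  fixes a b :: nat
  assumes "r \<le> f"
  shows "(\<Prod>i<f. if i < r then a else b) = a ^ r * b ^ (f - r)"
proof -
  have "(\<Prod>i<f. if i < r then a else b) = a ^ card ({..<f} \<inter> {i. i < r}) * b ^ card ({..<f} \<inter> - {i. i < r})"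
    by (simp add: prod.If_cases)
  also have "{..<f} \<inter> {i. i < r} = {..<r}" using assms by auto
  also have "{..<f} \<inter> - {i. i < r} = {r..<f}" by auto
  finally show ?thesis by simp
qed

lemma exists_discreet:
  fixes t f d :: nat
  defines "q \<equiv> t div f" and "r \<equiv> t mod f"
  assumes "0 < d" "d < f" "4 \<le> q" "x \<in> situations t f"
  obtains m A where "discreet t f d x m A"
    "(q - 2) ^ r * (q - 3) ^ (f - r) + 2 ^ (f - r) + 2 ^ r
      \<le> card (W t (syndrome t m A x) (situations t f) m A)"
proof -
  \<comment> \<open>The case \<open>f = 1\<close> does not arise, as \<open>0 < d < f\<close>.\<close>
  have "2 \<le> f" "r \<le> f" using assms by (auto simp: r_def)
  obtain P Q where pq: "piling t f P Q (q - 1) 3"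
    and c: "\<And>i. i < f \<Longrightarrow> card (P i - Q i) = (if i < r then q - 2 else q - 3)"
      "\<And>i. i < f \<Longrightarrow> card (P i \<inter> Q i) = (if i < r then 1 else 2)"
      "\<And>i. i < f \<Longrightarrow> card (Q i - P i) = (if i < r then 2 else 1)"
    and ex: "\<exists>s. (\<forall>i<f. s i \<in> P i - Q i) \<and> {c \<in> {1..t}. x c = 0} = s ` {..<f}"
    by (rule exists_piling[OF \<open>2 \<le> f\<close> assms(5)[unfolded q_def] assms(6), folded q_def r_def]) blast
  from ex obtain s where s: "\<And>i. i < f \<Longrightarrow> s i \<in> P i - Q i"
    "{c \<in> {1..t}. x c = 0} = s ` {..<f}"
    by blast
  interpret piling t f P Q "q - 1" 3 by (rule pq)
  have ev: "even_split x"
    using even_split_if_fakes_in_P_minus_Q[OF assms(6) s] .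
  have "(q - 2) ^ r * (q - 3) ^ (f - r) + 2 ^ (f - r) + 2 ^ r = card choices"
    unfolding card_choices using c \<open>r \<le> f\<close> by (simp add: prod_if_less)
  also note card_choices_le
  finally show ?thesis
    using that[OF discreet_comparisons[OF assms(6) ev assms(3,4)]]
    unfolding W_comparisons[OF assms(6) ev] by blast
qed

theorem mainTheorem2:
  fixes t f d :: nat and x :: "nat \<Rightarrow> int"
  assumes "0 < t" and "0 < f" and "0 < d"
    and "t div f \<ge> 4" and "d < f"
    and "x \<in> situations t f"
  shows "(\<exists>m A. optimal_discreet t f d x m A) \<and>
    (\<forall>m A. optimal_discreet t f d x m A \<longrightarrow>
       card (W t (syndrome t m A x) (situations t f) m A) \<ge>
         (t div f - 2) ^ (t - f * (t div f)) * (t div f - 3) ^ (f + f * (t div f) - t)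
         + 2 ^ (f + f * (t div f) - t) + 2 ^ (t - f * (t div f)))"
proof -
  let ?N = "\<lambda>m A. card (W t (syndrome t m A x) (situations t f) m A)"
  have exps: "t - f * (t div f) = t mod f" "f + f * (t div f) - t = f - t mod f"
    using mult_div_mod_eq[of f t] by linarith+
  obtain m A where dis: "discreet t f d x m A"
    and many: "(t div f - 2) ^ (t mod f) * (t div f - 3) ^ (f - t mod f)
      + 2 ^ (f - t mod f) + 2 ^ (t mod f) \<le> ?N m A"
    using exists_discreet[OF assms(3,5,4,6)] by blast
  define D where "D = (\<lambda>(m, A). discreet t f d x m A)"
  define N where "N = (\<lambda>(m, A). ?N m A)"
  have "N mA \<le> card (situations t f)" for mA
    using finite_situations by (auto simp: N_def W_def split: prod.split intro!: card_mono)
  moreover have "D (m, A)" using dis by (simp add: D_def)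
  ultimately obtain m' A' where "D (m', A')" "\<And>mA. D mA \<Longrightarrow> N mA \<le> N (m', A')"
    using ex_has_greatest_nat[of D "(m, A)" N "Suc (card (situations t f))"]
    by (auto simp: less_Suc_eq_le)
  hence "optimal_discreet t f d x m' A'"
    unfolding optimal_discreet_def D_def N_def by auto
  moreover have "?N m A \<le> ?N m' A'" if "optimal_discreet t f d x m' A'" for m' A'
    using that dis by (simp add: optimal_discreet_def)
  ultimately show ?thesis unfolding exps using many by (blast intro: order_trans)
qed

end
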